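(* Let $n_S,n_A\ge 1$ and let $\mathcal L\subseteq \mathfrak{u}(n_Sn_A)$ be the dynamical Lie algebra of the system $S+A$, with associated connected Lie group $e^{\mathcal L}$. Let $\rho_S$ and $\rho_A$ be density matrices of dimensions $n_S\times n_S$ and $n_A\times n_A$ respectively, with $\rho_S\neq \frac{1}{n_S}\mathbf 1_{n_S}$. Let $$\mathcal V:=\sum_{k=0}^{\infty}\mathrm{ad}_{\mathcal L}^k\bigl(\mathrm{span}\{i\rho_S\otimes\rho_A\}\bigr)\subseteq \mathfrak u(n_Sn_A).$$ Assume that for every $X\in SU(n_S)$ there exists $U\in e^{\mathcal L}$ such that $$\mathrm{Tr}_A\bigl(U(\rho_S\otimes\rho_A)U^\dagger\bigr)=X\rho_SX^\dagger .$$ Then $\mathrm{Tr}_A(\mathcal V)=\mathfrak u(n_S)$.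
   Context: $S$ and $A$ are finite-dimensional quantum systems with Hilbert spaces $\mathbb C^{n_S}$ and $\mathbb C^{n_A}$; a density matrix is a Hermitian positive semidefinite matrix of trace $1$. $\mathfrak u(n)$ is the real Lie algebra of $n\times n$ skew-Hermitian matrices; all spans and Lie algebras are over $\mathbb R$. $\mathbf 1_n$ is the $n\times n$ identity and $\mathbf 1$ an identity of the appropriate size. The Hamiltonian of $S+A$ is $H_S+H_A+H_I+\sum_k u_k(t)\,\mathbf 1_{n_S}\otimes L_k$, where $H_S=B\otimes\mathbf 1_{n_A}$, $H_A=\mathbf 1_{n_S}\otimes C$, $H_I=\sum_j B_j\otimes C_j$, with $B,B_j$ Hermitian $n_S\times n_S$ matrices, $C,C_j,L_k$ Hermitian $n_A\times n_A$ matrices (all Hamiltonians traceless), and $u_k$ real control functions. The dynamical Lie algebra $\mathcal L$ is the real Lie algebra generated by $iH_S+iH_I+iH_A$ and the matrices $i\mathbf 1_{n_S}\otimes L_k$; $e^{\mathcal L}$ is the connected Lie group with Lie algebra $\mathcal L$, i.e. the group generated by $\{e^{M}: M\in\mathcal L\}$. The partial trace $\mathrm{Tr}_A$ is the linear map determined by $\mathrm{Tr}_A(P\otimes Q)=\mathrm{Tr}(Q)\,P$ for $P$ an $n_S\times n_S$ and $Q$ an $n_A\times n_A$ matrix; it maps $\mathfrak u(n_Sn_A)$ into $\mathfrak u(n_S)$, and $\mathrm{Tr}_A(\mathcal V)$ denotes the image of $\mathcal V$. For a real subspace $\mathcal P\subseteq\mathfrak u(n_Sn_A)$, $\mathrm{ad}^0_{\mathcal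 L}\mathcal P=\mathcal P$ and $\mathrm{ad}^k_{\mathcal L}\mathcal P=[\mathcal L,\mathrm{ad}^{k-1}_{\mathcal L}\mathcal P]$, where $[\mathcal L,\mathcal Q]$ is the span of all commutators $[L,Q]=LQ-QL$ with $L\in\mathcal L$, $Q\in\mathcal Q$. Thus $\mathcal V$ is the smallest subspace of $\mathfrak u(n_Sn_A)$ that contains $i\rho_S\otimes\rho_A$ and is invariant under commutation with $\mathcal L$. *)

theory Defs
  imports "HOL-Analysis.Analysis"
begin

text \<open>
  Matrices are vectors of vectors, with product \<open>**\<close> and identity \<open>mat 1\<close>; the library's
  \<open>*\<close>, \<open>1\<close>, \<open>^\<close> on these types are componentwise and are not used here.
  \<open>span\<close> and \<open>subspace\<close> are taken over the reals.
\<close>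

type_synonym 'n cmat = "complex ^ 'n ^ 'n"

definition smult_mat :: "complex \<Rightarrow> 'n::finite cmat \<Rightarrow> 'n cmat"  (infixr "\<cdot>\<^sub>m" 75)
  where "c \<cdot>\<^sub>m M = map_matrix (\<lambda>z. c * z) M"

definition dagger :: "'n::finite cmat \<Rightarrow> 'n cmat"
  where "dagger M = map_matrix cnj (transpose M)"

definition hermitian :: "'n::finite cmat \<Rightarrow> bool"
  where "hermitian M \<longleftrightarrow> dagger M = M"

definition pos_semidef :: "'n::finite cmat \<Rightarrow> bool"
  where "pos_semidef M \<longleftrightarrow>
    hermitian M \<and> (\<forall>v :: complex ^ 'n. 0 \<le> Re (\<Sum>i\<in>UNIV. cnj (v $ i) * (M *v v) $ i))"

definition density_matrix :: "'n::finite cmat \<Rightarrow> bool"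
  where "density_matrix M \<longleftrightarrow> pos_semidef M \<and> trace M = 1"

definition skew_hermitian_mats :: "'n::finite cmat set"  ("\<uu>")
  where "\<uu> = {M. dagger M = - M}"

definition special_unitary :: "'n::finite cmat set"  ("SU")
  where "SU = {U. U ** dagger U = mat 1 \<and> dagger U ** U = mat 1 \<and> det U = 1}"

definition kron :: "'s::finite cmat \<Rightarrow> 'a::finite cmat \<Rightarrow> ('s \<times> 'a) cmat"  (infixl "\<otimes>\<^sub>K" 75)
  where "P \<otimes>\<^sub>K Q = (\<chi> i j. P $ fst i $ fst j * Q $ snd i $ snd j)"

definition partial_trace :: "('s::finite \<times> 'a::finite) cmat \<Rightarrow> 's cmat"  ("Tr\<^sub>A")
  where "Tr\<^sub>A M = (\<chi> i j. \<Sum>a\<in>UNIV. M $ (i, a) $ (j, a))"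

definition comm :: "'n::finite cmat \<Rightarrow> 'n cmat \<Rightarrow> 'n cmat"
  where "comm X Y = X ** Y - Y ** X"

definition lie_subalgebra :: "'n::finite cmat set \<Rightarrow> bool"
  where "lie_subalgebra V \<longleftrightarrow> subspace V \<and> (\<forall>X\<in>V. \<forall>Y\<in>V. comm X Y \<in> V)"

definition lie_generated :: "'n::finite cmat set \<Rightarrow> 'n cmat set"
  where "lie_generated G = lie_subalgebra hull G"

text \<open>\<open>H\<close> is the drift Hamiltonian of the whole system; \<open>Ls\<close> are the control Hamiltonians, which
  act on the second tensor factor only.\<close>

definition dynamical_lie_algebra ::
    "('s::finite \<times> 'a::finite) cmat \<Rightarrow> 'a cmat set \<Rightarrow> ('s \<times> 'a) cmat set"
  where "dynamical_lie_algebra H Ls =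
    lie_generated (insert (\<i> \<cdot>\<^sub>m H) ((\<lambda>L. \<i> \<cdot>\<^sub>m (mat 1 \<otimes>\<^sub>K L)) ` Ls))"

text \<open>The library's \<open>exp\<close> is not available: it needs a normed algebra, and the
  multiplication of the vector type is componentwise.\<close>

definition mat_pow :: "'n::finite cmat \<Rightarrow> nat \<Rightarrow> 'n cmat"
  where "mat_pow M k = (((**) M) ^^ k) (mat 1)"

definition mat_exp :: "'n::finite cmat \<Rightarrow> 'n cmat"
  where "mat_exp M = (\<Sum>k. (1 / fact k) *\<^sub>R mat_pow M k)"

inductive_set exp_group :: "'n::finite cmat set \<Rightarrow> 'n cmat set"
  for V :: "'n cmat set"
where
  exp: "M \<in> V \<Longrightarrow> mat_exp M \<in> exp_group V"
| one: "mat 1 \<in> exp_group V"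
| mult: "U \<in> exp_group V \<Longrightarrow> W \<in> exp_group V \<Longrightarrow> U ** W \<in> exp_group V"
| inv: "U \<in> exp_group V \<Longrightarrow> matrix_inv U \<in> exp_group V"

primrec ad_iter :: "nat \<Rightarrow> 'n::finite cmat set \<Rightarrow> 'n cmat set \<Rightarrow> 'n cmat set"
where
  "ad_iter 0 V P = P"
| "ad_iter (Suc k) V P = span {comm X Q | X Q. X \<in> V \<and> Q \<in> ad_iter k V P}"

text \<open>The sum of a family of subspaces is the span of their union.\<close>

definition ad_sum :: "'n::finite cmat set \<Rightarrow> 'n cmat set \<Rightarrow> 'n cmat set"
  where "ad_sum V P = span (\<Union>k. ad_iter k V P)"

lemma partial_trace_kron: "Tr\<^sub>A (P \<otimes>\<^sub>K Q) = trace Q \<cdot>\<^sub>m P"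
  by (simp add: partial_trace_def kron_def smult_mat_def trace_def vec_eq_iff
      sum_distrib_left[symmetric] mult.commute)

lemma partial_trace_add: "Tr\<^sub>A (M + N) = Tr\<^sub>A M + Tr\<^sub>A N"
  by (simp add: partial_trace_def vec_eq_iff sum.distrib)

lemma partial_trace_smult: "Tr\<^sub>A (c \<cdot>\<^sub>m M) = c \<cdot>\<^sub>m Tr\<^sub>A M"
  by (simp add: partial_trace_def smult_mat_def vec_eq_iff sum_distrib_left)

lemma mat_exp_sums:
  fixes M :: "'n::finite cmat"
  shows "(\<lambda>k. (1 / fact k) *\<^sub>R mat_pow M k) sums mat_exp M"
proof -
  have "bilinear ((**) :: 'n cmat \<Rightarrow> 'n cmat \<Rightarrow> 'n cmat)"
    by (simp add: bilinear_def linear_iff matrix_matrix_mult_def vec_eq_iff algebra_simps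
        sum.distrib scaleR_sum_right)
  from bilinear_bounded[OF this] obtain K where K: "\<And>(A :: 'n cmat) (B :: 'n cmat). norm (A ** B) \<le> K * norm A * norm B"
    by blast
  define c where "c = \<bar>K\<bar> * norm M"
  have bound: "norm (mat_pow M k) \<le> c ^ k * norm (mat 1 :: 'n cmat)" for k
  proof (induction k)
    case (Suc k)
    have "norm (mat_pow M (Suc k)) \<le> K * norm M * norm (mat_pow M k)"
      using K by (simp add: mat_pow_def)
    also have "\<dots> \<le> c * norm (mat_pow M k)"
      unfolding c_def by (intro mult_right_mono) auto
    also have "\<dots> \<le> c * (c ^ k * norm (mat 1 :: 'n cmat))"
      using Suc by (intro mult_left_mono) (auto simp: c_def)
    finally show ?case by simp
  qed (simp add: mat_pow_def)
  have "summable (\<lambda>k. inverse (fact k) * c ^ k * norm (mat 1 :: 'n cmat))"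
    by (intro summable_mult2 summable_exp)
  then have "summable (\<lambda>k. (1 / fact k) *\<^sub>R mat_pow M k)"
    using bound by (rule_tac summable_comparison_test) (auto simp: field_simps intro!: divide_right_mono)
  then show ?thesis
    unfolding mat_exp_def by (rule summable_sums)
qed

end

theory Submission
  imports Defs
begin

text \<open>
  The generators are skew-Hermitian, so conjugation by \<open>e\<^sup>M\<close> with \<open>M \<in> \<L>\<close> acts on
  \<open>\<V>\<close> as the exponential of \<open>ad\<^sub>M\<close> and preserves it. By
  controllability \<open>Tr\<^sub>A \<V>\<close> therefore contains the whole \<open>SU\<close>-orbit of \<open>\<i> \<rho>\<^sub>S\<close>,
  which is also its orbit under all unitaries, as scalars act trivially. Let \<open>S\<close> be the real span
  of this orbit. For an orthogonal projection \<open>P\<close>, conjugating by the unitaries \<open>1 - 2P\<close> and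
  \<open>1 - P + \<i>P\<close> shows \<open>[\<i>P, A] \<in> S\<close> for all \<open>A \<in> S\<close>. Such \<open>\<i>P\<close> span the skew-Hermitian matrices,
  so \<open>S\<close> is an ideal; containing a nonscalar matrix of nonzero trace, it is everything.
\<close>

section \<open>Matrix algebra\<close>

lemma matrix_scaleR_mult:
  fixes A B :: "'n::finite cmat"
  shows "(c *\<^sub>R A) ** B = c *\<^sub>R (A ** B)" "A ** (c *\<^sub>R B) = c *\<^sub>R (A ** B)"
  by (simp_all add: matrix_matrix_mult_def vec_eq_iff scaleR_sum_right)

lemma matrix_smult_mult:
  fixes A B :: "'n::finite cmat"
  shows "(c \<cdot>\<^sub>m A) ** B = c \<cdot>\<^sub>m (A ** B)" "A ** (c \<cdot>\<^sub>m B) = c \<cdot>\<^sub>m (A ** B)"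
  by (simp_all add: smult_mat_def map_matrix_def matrix_matrix_mult_def vec_eq_iff
      sum_distrib_left mult.left_commute mult.assoc)

lemma matrix_uminus_mult:
  fixes A B :: "'n::finite cmat"
  shows "(- A) ** B = - (A ** B)" "A ** (- B) = - (A ** B)"
  by (simp_all add: matrix_matrix_mult_def vec_eq_iff sum_negf)

lemma matrix_diff_distrib:
  fixes A B C :: "'n::finite cmat"
  shows "(A - B) ** C = A ** C - B ** C" "A ** (B - C) = A ** B - A ** C"
  by (simp_all add: matrix_matrix_mult_def vec_eq_iff sum_subtractf algebra_simps)

lemma matrix_add_distrib:
  fixes A B C :: "'n::finite cmat"
  shows "(A + B) ** C = A ** C + B ** C" "A ** (B + C) = A ** B + A ** C"
  by (simp_all add: matrix_matrix_mult_def vec_eq_iff sum.distrib algebra_simps)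

lemma matrix_sum_distrib:
  fixes F :: "'i \<Rightarrow> 'n::finite cmat"
  shows "(\<Sum>i\<in>I. F i) ** C = (\<Sum>i\<in>I. F i ** C)" "C ** (\<Sum>i\<in>I. F i) = (\<Sum>i\<in>I. C ** F i)"
  by (induction I rule: infinite_finite_induct) (auto simp: matrix_add_distrib)

lemmas scaleR_complex = scaleR_conv_of_real[where 'a = complex]

section \<open>Entrywise rules for complex scaling, the adjoint and the commutator\<close>

lemma smult_mat_nth [simp]: "(c \<cdot>\<^sub>m A) $ i $ j = c * A $ i $ j"
  by (simp add: smult_mat_def)

lemma smult_mat_simps [simp]:
  fixes A :: "'n::finite cmat"
  shows "a \<cdot>\<^sub>m (b \<cdot>\<^sub>m A) = (a * b) \<cdot>\<^sub>m A" "1 \<cdot>\<^sub>m A = A" "(-1) \<cdot>\<^sub>m A = - A"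
    "a \<cdot>\<^sub>m 0 = (0 :: 'n cmat)"
  by (simp_all add: vec_eq_iff)

lemma dagger_nth [simp]: "dagger A $ i $ j = cnj (A $ j $ i)"
  by (simp add: dagger_def transpose_def)

lemma dagger_simps [simp]:
  fixes A B :: "'n::finite cmat"
  shows "dagger (dagger A) = A" "dagger (A + B) = dagger A + dagger B"
    "dagger (A - B) = dagger A - dagger B" "dagger (- A) = - dagger A"
    "dagger (c *\<^sub>R A) = c *\<^sub>R dagger A" "dagger (z \<cdot>\<^sub>m A) = cnj z \<cdot>\<^sub>m dagger A"
    "dagger 0 = (0 :: 'n cmat)" "dagger (mat 1) = (mat 1 :: 'n cmat)"
  by (auto simp: vec_eq_iff mat_def)

lemma dagger_mult [simp]: "dagger (A ** B) = dagger B ** dagger A"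
  by (simp add: vec_eq_iff matrix_matrix_mult_def mult.commute)

lemma comm_linear:
  fixes A B C :: "'n::finite cmat"
  shows "comm (A + B) C = comm A C + comm B C" "comm A (B + C) = comm A B + comm A C"
    "comm (c *\<^sub>R A) B = c *\<^sub>R comm A B" "comm A (c *\<^sub>R B) = c *\<^sub>R comm A B"
    "comm 0 A = 0" "comm A 0 = 0"
  by (simp_all add: comm_def matrix_add_distrib matrix_scaleR_mult algebra_simps)

section \<open>Closure properties of Hermitian and skew-Hermitian matrices\<close>

lemma subspace_skew_hermitian: "subspace (\<uu> :: 'n::finite cmat set)"
  by (simp add: subspace_def skew_hermitian_mats_def)

lemma comm_skew_hermitian:
  fixes A B :: "'n::finite cmat"
  assumes "A \<in> \<uu>" "B \<in> \<uu>"
  shows "comm A B \<in> \<uu>"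
  using assms by (simp add: skew_hermitian_mats_def comm_def matrix_uminus_mult)

lemma smult_hermitian_skew: "hermitian A \<Longrightarrow> \<i> \<cdot>\<^sub>m A \<in> \<uu>"
  by (simp add: hermitian_def skew_hermitian_mats_def vec_eq_iff)

lemma hermitian_kron: "hermitian P \<Longrightarrow> hermitian Q \<Longrightarrow> hermitian (P \<otimes>\<^sub>K Q)"
  by (simp add: hermitian_def kron_def vec_eq_iff)

lemma hermitian_add: "hermitian P \<Longrightarrow> hermitian Q \<Longrightarrow> hermitian (P + Q)"
  by (simp add: hermitian_def)

lemma hermitian_sum: "(\<And>i. i \<in> I \<Longrightarrow> hermitian (F i)) \<Longrightarrow> hermitian (\<Sum>i\<in>I. F i)"
  by (induction I rule: infinite_finite_induct) (auto simp: hermitian_def)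

lemma hermitian_one: "hermitian (mat 1)"
  by (simp add: hermitian_def)

section \<open>Conjugation by matrix exponentials\<close>

text \<open>Bilinear maps in finite dimension are bounded. The constant \<open>c\<close> takes the
  place of submultiplicativity of the norm in the estimates for the exponential series.\<close>

lemma matrix_mult_norm_bound:
  obtains c where "c \<ge> 0" "\<And>(A :: 'n::finite cmat) (B :: 'n cmat). norm (A ** B) \<le> c * norm A * norm B"
proof -
  have "bilinear ((**) :: 'n cmat \<Rightarrow> 'n cmat \<Rightarrow> 'n cmat)"
    by (simp add: bilinear_def linear_iff matrix_add_distrib matrix_scaleR_mult)
  from bilinear_bounded_pos[OF this] obtain c
    where "c > 0" "\<And>(A :: 'n cmat) (B :: 'n cmat). norm (A ** B) \<le> c * norm A * norm B"
    by blast
  then show ?thesis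
    using that[of c] by simp
qed

text \<open>Comparison with the scalar exponential series at \<open>c * norm M\<close>. Absolute
  convergence is what the Cauchy product below requires.\<close>

lemma summable_norm_mat_exp:
  fixes M :: "'n::finite cmat"
  shows "summable (\<lambda>k. norm ((1 / fact k) *\<^sub>R mat_pow M k))"
proof -
  obtain c where c: "c \<ge> 0" "\<And>(A :: 'n cmat) (B :: 'n cmat). norm (A ** B) \<le> c * norm A * norm B"
    by (rule matrix_mult_norm_bound) (rule that)
  have bound: "norm (mat_pow M k) \<le> (c * norm M) ^ k * norm (mat 1 :: 'n cmat)" for k
  proof (induction k)
    case (Suc k)
    have "norm (mat_pow M (Suc k)) \<le> c * norm M * norm (mat_pow M k)"
      using c(2)[of M "mat_pow M k"] by (simp add: mat_pow_def)
    also have "\<dots> \<le> c * norm M * ((c * norm M) ^ k * norm (mat 1 :: 'n cmat))"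
      using Suc c by (intro mult_left_mono) auto
    finally show ?case by (simp add: mult.assoc)
  qed (simp add: mat_pow_def)
  have "summable (\<lambda>k. inverse (fact k) * (c * norm M) ^ k * norm (mat 1 :: 'n cmat))"
    by (intro summable_mult2 summable_exp)
  then show ?thesis
    by (rule summable_comparison_test[rotated])
      (use bound in \<open>auto simp: field_simps intro!: divide_right_mono\<close>)
qed

text \<open>Each entry of \<open>x ** y\<close> is a finite sum of products of absolutely convergent
  scalar series, so the scalar Cauchy product applies entry by entry; convergence of vectors is
  componentwise.\<close>

lemma matrix_Cauchy_product_sums:
  fixes X Y :: "nat \<Rightarrow> 'n::finite cmat"
  assumes X: "X sums x" "summable (\<lambda>k. norm (X k))"
    and Y: "Y sums y" "summable (\<lambda>k. norm (Y k))"
  shows "(\<lambda>n. \<Sum>p\<le>n. X p ** Y (n - p)) sums (x ** y)"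
proof -
  have entry_sums: "(\<lambda>k. Z k $ i $ j) sums (z $ i $ j)" if "Z sums z" for Z and z :: "'n cmat" and i j
    using tendsto_vec_nth[OF tendsto_vec_nth[OF that[unfolded sums_def]], of i j]
    by (simp add: sums_def)
  have entry_summable: "summable (\<lambda>k. norm (Z k $ i $ j))"
    if "summable (\<lambda>k. norm (Z k))" for Z :: "nat \<Rightarrow> 'n cmat" and i j
    by (rule summable_comparison_test[OF _ that])
      (auto intro!: exI[of _ 0] intro: order_trans[OF Finite_Cartesian_Product.norm_nth_le
        Finite_Cartesian_Product.norm_nth_le])
  have *: "(\<lambda>n. (\<Sum>p\<le>n. X p ** Y (n - p)) $ i $ j) sums ((x ** y) $ i $ j)" for i j
  proof -
    have "(\<lambda>n. \<Sum>l\<in>UNIV. \<Sum>p\<le>n. X p $ i $ l * Y (n - p) $ l $ j)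
        sums (\<Sum>l\<in>UNIV. (\<Sum>k. X k $ i $ l) * (\<Sum>k. Y k $ l $ j))"
      by (intro sums_sum Cauchy_product_sums entry_summable X Y)
    also have "(\<Sum>l\<in>UNIV. (\<Sum>k. X k $ i $ l) * (\<Sum>k. Y k $ l $ j)) = (x ** y) $ i $ j"
      by (simp add: matrix_matrix_mult_def sums_unique[OF entry_sums[OF X(1)]]
          sums_unique[OF entry_sums[OF Y(1)]])
    finally show ?thesis
      by (subst (asm) sum.swap) (simp add: matrix_matrix_mult_def)
  qed
  show ?thesis
    unfolding sums_def
    by (intro vec_tendstoI) (use * in \<open>simp add: sums_def\<close>)
qed

lemma mat_pow_commute: "mat_pow M k ** M = M ** mat_pow M k"
proof (induction k)
  case (Suc k)
  then show ?case
    by (simp add: mat_pow_def matrix_mul_assoc[symmetric])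
qed (simp add: mat_pow_def)

text \<open>The homogeneous parts \<open>c\<^sub>n\<close> of \<open>e\<^sup>M v e\<^sup>-\<^sup>M\<close> satisfy \<open>(n + 1) c\<^sub>n\<^sub>+\<^sub>1 = [M, c\<^sub>n]\<close>, that is
  \<open>c\<^sub>n = ad\<^sub>M\<^sup>n v / n!\<close>.\<close>

lemma mat_exp_conj_sums:
  fixes M v :: "'n::finite cmat"
  obtains c where "c sums (mat_exp M ** v ** mat_exp (- M))" "c 0 = v"
    "\<And>n. real (Suc n) *\<^sub>R c (Suc n) = comm M (c n)"
proof -
  define a b where "a k = (1 / fact k) *\<^sub>R mat_pow M k"
    and "b k = (1 / fact k) *\<^sub>R mat_pow (- M) k" for k
  define c where "c n = (\<Sum>p\<le>n. (a p ** v) ** b (n - p))" for n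
  have a_Suc: "real (Suc k) *\<^sub>R a (Suc k) = M ** a k" for k
    by (simp add: a_def mat_pow_def matrix_scaleR_mult del: of_nat_Suc)
  have b_Suc: "real (Suc k) *\<^sub>R b (Suc k) = - (b k ** M)" for k
    using mat_pow_commute[of "- M" k]
    by (simp add: b_def mat_pow_def matrix_scaleR_mult matrix_uminus_mult del: of_nat_Suc)
  obtain K where K: "\<And>(A :: 'n cmat) (B :: 'n cmat). norm (A ** B) \<le> K * norm A * norm B"
    by (rule matrix_mult_norm_bound) (rule that)
  have bl: "bounded_linear (\<lambda>A :: 'n cmat. A ** v)"
    by (simp add: linear_conv_bounded_linear[symmetric] linear_iff matrix_add_distrib matrix_scaleR_mult)
  have "summable (\<lambda>k. norm (a k) * (K * norm v))"
    unfolding a_def by (intro summable_mult2 summable_norm_mat_exp)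
  then have "summable (\<lambda>k. norm (a k ** v))"
    by (rule summable_comparison_test[rotated])
      (use K[of "a _" v] in \<open>auto intro!: exI[of _ 0] simp: mult_ac\<close>)
  moreover have "(\<lambda>k. a k ** v) sums (mat_exp M ** v)"
    unfolding a_def by (intro bounded_linear.sums[OF bl] mat_exp_sums)
  moreover have "b sums mat_exp (- M)" "summable (\<lambda>k. norm (b k))"
    unfolding b_def by (intro mat_exp_sums summable_norm_mat_exp)+
  ultimately have "c sums (mat_exp M ** v ** mat_exp (- M))"
    unfolding c_def by (intro matrix_Cauchy_product_sums)
  moreover have "c 0 = v"
    by (simp add: c_def a_def b_def mat_pow_def)
  moreover have "real (Suc n) *\<^sub>R c (Suc n) = comm M (c n)" for n
  proof -
    let ?t = "\<lambda>p. (a p ** v) ** b (Suc n - p)"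
    \<comment> \<open>Leibniz rule in discrete form: the weight \<open>Suc n\<close> is split as
      \<open>p + (Suc n - p)\<close>. The first part is absorbed by \<open>a p\<close> and the
      second by \<open>b (Suc n - p)\<close>; the boundary terms \<open>p = 0\<close> and
      \<open>p = Suc n\<close> vanish, which permits the index shifts.\<close>
    have "real (Suc n) *\<^sub>R c (Suc n)
        = (\<Sum>p\<le>Suc n. real p *\<^sub>R ?t p) + (\<Sum>p\<le>Suc n. real (Suc n - p) *\<^sub>R ?t p)"
      unfolding c_def scaleR_sum_right sum.distrib[symmetric] scaleR_add_left[symmetric]
      by (intro sum.cong) (auto simp del: of_nat_Suc simp flip: of_nat_add)
    also have "(\<Sum>p\<le>Suc n. real p *\<^sub>R ?t p) = (\<Sum>p\<le>n. (real (Suc p) *\<^sub>R a (Suc p)) ** v ** b (n - p))"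
      by (subst sum.atMost_Suc_shift) (simp add: matrix_scaleR_mult)
    also have "\<dots> = M ** c n"
      unfolding a_Suc by (simp add: c_def matrix_sum_distrib matrix_mul_assoc)
    also have "(\<Sum>p\<le>Suc n. real (Suc n - p) *\<^sub>R ?t p)
        = (\<Sum>p\<le>n. (a p ** v) ** (real (Suc (n - p)) *\<^sub>R b (Suc (n - p))))"
      by (subst sum.atMost_Suc) (auto simp: matrix_scaleR_mult Suc_diff_le simp del: of_nat_Suc intro!: sum.cong)
    also have "\<dots> = - (c n ** M)"
      unfolding b_Suc
      by (simp add: c_def matrix_sum_distrib matrix_mul_assoc matrix_uminus_mult sum_negf)
    finally show ?thesis by (simp add: comm_def)
  qed
  ultimately show ?thesis by (rule that)
qed

text \<open>Conjugating \<open>mat 1\<close>: it commutes with \<open>M\<close>, so the recursion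
  kills every homogeneous part of positive degree.\<close>

lemma mat_exp_minus: "mat_exp M ** mat_exp (- M) = mat 1"
proof -
  obtain c where c: "c sums (mat_exp M ** mat 1 ** mat_exp (- M))" "c 0 = mat 1"
    and rec: "\<And>n. real (Suc n) *\<^sub>R c (Suc n) = comm M (c n)"
    using mat_exp_conj_sums by blast
  have "c (Suc n) = 0" for n
  proof (induction n)
    case 0
    show ?case using rec[of 0] c(2) by (simp add: comm_def)
  next
    case (Suc n)
    then show ?case using rec[of "Suc n"] by (simp add: comm_linear del: of_nat_Suc)
  qed
  then have "c = (\<lambda>n. if n = 0 then mat 1 else 0)"
    using c(2) by (intro ext) (metis not0_implies_Suc)
  then have "c sums mat 1"
    using sums_single[of 0 "\<lambda>_. mat 1"] by simp
  then show ?thesis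
    using c(1) sums_unique2 by fastforce
qed

text \<open>By the recursion all homogeneous parts lie in \<open>V\<close>, hence so do the partial
  sums; the limit stays in \<open>V\<close> because a finite-dimensional subspace is closed.\<close>

lemma mat_exp_conj_mem:
  assumes V: "subspace V" "\<And>Q. Q \<in> V \<Longrightarrow> comm M Q \<in> V" and v: "v \<in> V"
  shows "mat_exp M ** v ** mat_exp (- M) \<in> V"
proof -
  obtain c where c: "c sums (mat_exp M ** v ** mat_exp (- M))" "c 0 = v"
    and rec: "\<And>n. real (Suc n) *\<^sub>R c (Suc n) = comm M (c n)"
    using mat_exp_conj_sums by blast
  have "c n \<in> V" for n
  proof (induction n)
    case (Suc n)
    have "c (Suc n) = (1 / real (Suc n)) *\<^sub>R comm M (c n)"
      unfolding rec[symmetric] by (simp del: of_nat_Suc)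
    then show ?case
      using V Suc by (simp add: subspace_mul)
  qed (use v c in simp)
  then have "(\<Sum>k<n. c k) \<in> V" for n
    using V(1) by (intro subspace_sum)
  then show ?thesis
    using closed_sequentially[OF closed_subspace[OF V(1)]] c(1)[unfolded sums_def] by fast
qed

lemma dagger_mat_exp:
  assumes "M \<in> \<uu>"
  shows "dagger (mat_exp M) = mat_exp (- M)"
proof -
  have pow: "dagger (mat_pow M k) = mat_pow (- M) k" for k
  proof (induction k)
    case (Suc k)
    have "dagger (mat_pow M (Suc k)) = mat_pow (- M) k ** (- M)"
      using Suc assms by (simp add: mat_pow_def skew_hermitian_mats_def)
    then show ?case
      by (simp only: mat_pow_commute) (simp add: mat_pow_def)
  qed (simp add: mat_pow_def)
  have "bounded_linear (dagger :: 'a cmat \<Rightarrow> 'a cmat)"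
    by (simp add: linear_conv_bounded_linear[symmetric] linear_iff)
  from bounded_linear.sums[OF this mat_exp_sums[of M]] show ?thesis
    using mat_exp_sums[of "- M"] sums_unique2 by (fastforce simp: pow)
qed

text \<open>The induction carries unitarity and both directions of conjugation at once: in the
  inverse case \<open>matrix_inv U\<close> equals \<open>dagger U\<close>, and the two directions
  trade places.\<close>

lemma exp_group_conj:
  assumes V: "subspace V" and inv: "\<And>M Q. M \<in> L \<Longrightarrow> Q \<in> V \<Longrightarrow> comm M Q \<in> V"
    and L: "subspace L" "L \<subseteq> \<uu>"
    and U: "U \<in> exp_group L"
  shows "U ** dagger U = mat 1 \<and> (\<forall>v\<in>V. U ** v ** dagger U \<in> V \<and> dagger U ** v ** U \<in> V)"
  using U
proof induction
  case (exp M)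
  have "- M \<in> L"
    using exp L subspace_neg by blast
  then have "mat_exp (- M) ** v ** mat_exp (- (- M)) \<in> V" if "v \<in> V" for v
    by (intro mat_exp_conj_mem V inv that)
  moreover have "mat_exp M ** v ** mat_exp (- M) \<in> V" if "v \<in> V" for v
    by (intro mat_exp_conj_mem V inv that exp)
  moreover have "dagger (mat_exp M) = mat_exp (- M)"
    using exp L by (intro dagger_mat_exp) auto
  ultimately show ?case
    by (simp add: mat_exp_minus)
next
  case (mult U W)
  have "U ** W ** (dagger W ** dagger U) = U ** (W ** dagger W) ** dagger U"
    by (simp only: matrix_mul_assoc)
  moreover have "U ** W ** v ** (dagger W ** dagger U) = U ** (W ** v ** dagger W) ** dagger U" for v
    by (simp only: matrix_mul_assoc)
  moreover have "dagger W ** dagger U ** v ** (U ** W) = dagger W ** (dagger U ** v ** U) ** W" for v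
    by (simp only: matrix_mul_assoc)
  ultimately show ?case
    using mult by (simp only: dagger_mult) simp
next
  case (inv U)
  then have U: "U ** dagger U = mat 1" "dagger U ** U = mat 1"
    using matrix_left_right_inverse[of U "dagger U"] by auto
  \<comment> \<open>\<open>matrix_inv\<close> is a choice operator; \<open>dagger U\<close>, being a
    two-sided inverse, shows that the choice succeeds.\<close>
  then have "U ** matrix_inv U = mat 1"
    unfolding matrix_inv_def using someI_ex[of "\<lambda>A. U ** A = mat 1 \<and> A ** U = mat 1"] by blast
  then have "dagger U ** (U ** matrix_inv U) = dagger U"
    by simp
  then have "matrix_inv U = dagger U"
    by (simp add: matrix_mul_assoc U)
  then show ?case
    using inv U by simp
qed simp

section \<open>Conjugation-invariant subspaces of the unitary Lie algebra\<close>

definition unitary_mats :: "'n::finite cmat set"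
  where "unitary_mats = {U. U ** dagger U = mat 1}"

text \<open>Invariance is asked under all unitaries and not only those of determinant one, so that
  simple functions of a projection such as \<open>mat 1 - 2 *\<^sub>R P\<close> can be used
  directly.\<close>

definition conj_invariant :: "'n::finite cmat set \<Rightarrow> bool"
  where "conj_invariant S \<longleftrightarrow> subspace S \<and> (\<forall>U\<in>unitary_mats. \<forall>A\<in>S. U ** A ** dagger U \<in> S)"

lemma trace_smult: "trace (z \<cdot>\<^sub>m A) = z * trace A"
  by (simp add: trace_def sum_distrib_left)

text \<open>A unimodular factor \<open>z\<close> cancels in conjugation, since
  \<open>z * cnj z = 1\<close>; it is chosen to cancel the determinant.\<close>

lemma unitary_rescale_SU:
  fixes U :: "'n::finite cmat"
  assumes "U \<in> unitary_mats"
  obtains X where "X \<in> SU" "\<And>A. X ** A ** dagger X = U ** A ** dagger U"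
proof -
  have U: "U ** dagger U = mat 1"
    using assms by (simp add: unitary_mats_def)
  have det_smult: "det (z \<cdot>\<^sub>m A) = z ^ CARD('n) * det A" for z and A :: "'n cmat"
  proof -
    have "z \<cdot>\<^sub>m A = (\<chi> i. z *s A $ i)"
      by (simp add: vec_eq_iff)
    then show ?thesis
      using det_rows_mul[of "\<lambda>_. z" "\<lambda>i. A $ i"] by simp
  qed
  have "det (dagger U) = cnj (det U)"
  proof -
    have "det (dagger U) = det (\<chi> i j. cnj (U $ i $ j))"
      by (subst det_transpose[symmetric]) (simp add: transpose_def dagger_def map_matrix_def)
    then show ?thesis
      by (simp add: det_def)
  qed
  then have "det U * cnj (det U) = 1"
    using arg_cong[OF U, of det] by (simp add: det_mul)
  then have "norm (det U) = 1"
    by (metis complex_mod_mult_cnj norm_one power2_eq_1_iff norm_ge_zero one_neq_neg_one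
        abs_norm_cancel abs_1 real_sqrt_abs power_one real_sqrt_one)
  then obtain t where t: "det U = cis t"
    by (metis complex_norm_eq_1_exp cis_conv_exp)
  \<comment> \<open>An n-th root of \<open>cis (- t)\<close>, the inverse of \<open>det U\<close>,
    because scaling by \<open>z\<close> multiplies the determinant by
    \<open>z ^ CARD('n)\<close>.\<close>
  define z where "z = cis (- t / CARD('n))"
  have "real CARD('n) * (- t / CARD('n)) = - t"
    by simp
  then have "z ^ CARD('n) = cis (- t)"
    by (simp only: z_def Complex.DeMoivre)
  then have "det (z \<cdot>\<^sub>m U) = 1"
    by (simp add: det_smult t cis_mult)
  moreover have z: "z * cnj z = 1" "cnj z * z = 1"
    by (simp_all add: z_def cis_cnj cis_mult)
  moreover have "dagger U ** U = mat 1"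
    using U matrix_left_right_inverse by blast
  ultimately show ?thesis
    using U by (intro that[of "z \<cdot>\<^sub>m U"]) (simp_all add: special_unitary_def matrix_smult_mult)
qed

lemma conj_invariant_comm_projection:
  fixes P :: "'n::finite cmat"
  assumes S: "conj_invariant S" and P: "hermitian P" "P ** P = P" and A: "A \<in> S"
  shows "comm (\<i> \<cdot>\<^sub>m P) A \<in> S"
proof -
  have PA: "P ** (P ** X) = P ** X" for X
    by (simp add: matrix_mul_assoc P)
  note alg = matrix_add_distrib matrix_diff_distrib matrix_scaleR_mult matrix_smult_mult
    matrix_mul_assoc[symmetric] PA P
  have dP: "dagger P = P"
    using P by (simp add: hermitian_def)
  let ?U = "mat 1 - 2 *\<^sub>R P" and ?W = "mat 1 - P + \<i> \<cdot>\<^sub>m P"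
  have conj: "U ** A ** dagger U \<in> S" if "U ** dagger U = mat 1" for U
    using S A that by (auto simp: conj_invariant_def unitary_mats_def)
  have "?U ** A ** dagger ?U \<in> S" "?W ** A ** dagger ?W \<in> S"
    by (intro conj; simp add: alg dP; simp add: vec_eq_iff algebra_simps)+
  \<comment> \<open>Conjugation by \<open>?W\<close> changes \<open>A\<close> by i(PA - AP) - (PA +
    AP) + 2PAP, while A minus its conjugate by \<open>?U\<close> is 2(PA + AP) - 4PAP. Half of the
    latter removes the symmetric terms and leaves the commutator.\<close>
  moreover have "comm (\<i> \<cdot>\<^sub>m P) A
      = (?W ** A ** dagger ?W - A) + (1/2) *\<^sub>R (A - ?U ** A ** dagger ?U)"
    by (simp add: alg dP comm_def) (simp add: vec_eq_iff algebra_simps scaleR_complex)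
  moreover have "subspace S"
    using S by (simp add: conj_invariant_def)
  ultimately show ?thesis
    using A by (auto intro!: subspace_add subspace_diff subspace_mul)
qed

section \<open>Matrix units and skew-Hermitian matrices supported on one pair of indices\<close>

definition unit_mat :: "'n::finite \<Rightarrow> 'n \<Rightarrow> 'n cmat"
  where "unit_mat p q = (\<chi> i j. if i = p \<and> j = q then 1 else 0)"

text \<open>The form is additive and real-homogeneous in \<open>w\<close>, and also covers the
  diagonal: for \<open>p = q\<close> it collapses to a real multiple of
  \<open>\<i> \<cdot>\<^sub>m unit_mat p p\<close>.\<close>

definition skew_unit :: "'n::finite \<Rightarrow> 'n \<Rightarrow> complex \<Rightarrow> 'n cmat"
  where "skew_unit p q w = w \<cdot>\<^sub>m unit_mat p q - cnj w \<cdot>\<^sub>m unit_mat q p"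

lemma unit_mat_nth: "unit_mat p q $ i $ j = (if i = p \<and> j = q then 1 else 0)"
  by (simp add: unit_mat_def)

lemma skew_unit_nth: "skew_unit p q w $ i $ j
    = (if i = p \<and> j = q then w else 0) - (if i = q \<and> j = p then cnj w else 0)"
  by (simp only: skew_unit_def unit_mat_nth smult_mat_nth vector_minus_component
      if_distrib[of "(*) _"] mult_1_right mult_zero_right)

lemma unit_mat_mult:
  "(unit_mat p q ** A) $ i $ j = (if i = p then A $ q $ j else 0)"
  "(A ** unit_mat p q) $ i $ j = (if j = q then A $ i $ p else 0)"
proof -
  have "(\<Sum>k\<in>UNIV. (if i = p \<and> k = q then 1 else 0) * A $ k $ j)
      = (\<Sum>k\<in>UNIV. if k = q then if i = p then A $ k $ j else 0 else 0)"
    by (intro sum.cong) auto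
  then show "(unit_mat p q ** A) $ i $ j = (if i = p then A $ q $ j else 0)"
    by (simp add: matrix_matrix_mult_def unit_mat_nth sum.delta)
  have "(\<Sum>k\<in>UNIV. A $ i $ k * (if k = p \<and> j = q then 1 else 0))
      = (\<Sum>k\<in>UNIV. if k = p then if j = q then A $ i $ k else 0 else 0)"
    by (intro sum.cong) auto
  then show "(A ** unit_mat p q) $ i $ j = (if j = q then A $ i $ p else 0)"
    by (simp add: matrix_matrix_mult_def unit_mat_nth sum.delta)
qed

lemma unit_mat_mult_unit_mat: "unit_mat p q ** unit_mat r s = (if q = r then unit_mat p s else 0)"
  by (cases "q = r") (auto simp: vec_eq_iff unit_mat_mult unit_mat_nth)

lemma dagger_unit_mat [simp]: "dagger (unit_mat p q) = unit_mat q p"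
  by (simp add: vec_eq_iff unit_mat_nth conj_commute)

lemma skew_unit_swap: "skew_unit q p w = skew_unit p q (- cnj w)"
  by (simp add: skew_unit_def vec_eq_iff)

lemma skew_unit_add: "skew_unit p q (v + w) = skew_unit p q v + skew_unit p q w"
  by (simp add: skew_unit_def vec_eq_iff algebra_simps)

lemma skew_unit_scaleR: "skew_unit p q (c *\<^sub>R w) = c *\<^sub>R skew_unit p q w"
  by (simp add: skew_unit_def vec_eq_iff scaleR_complex algebra_simps)

lemma skew_unit_diag: "skew_unit p p w = (2 * Im w) *\<^sub>R (\<i> \<cdot>\<^sub>m unit_mat p p)"
proof -
  have "skew_unit p p w = (w - cnj w) \<cdot>\<^sub>m unit_mat p p"
    by (simp add: skew_unit_def vec_eq_iff algebra_simps)
  then show ?thesis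
    by (simp add: complex_diff_cnj vec_eq_iff scaleR_complex)
qed

text \<open>The sum runs over ordered pairs, so entry (i, j) is produced once by (i, j) and once by
  (j, i); the factor 1/2 corrects this, on the diagonal as well.\<close>

lemma skew_hermitian_eq_sum:
  fixes A :: "'n::finite cmat"
  assumes "A \<in> \<uu>"
  shows "A = (1/2) *\<^sub>R (\<Sum>p\<in>UNIV. \<Sum>q\<in>UNIV. skew_unit p q (A $ p $ q))"
proof -
  have A: "cnj (A $ i $ j) = - A $ j $ i" for i j
    using assms by (simp add: skew_hermitian_mats_def vec_eq_iff)
  have "(\<Sum>p\<in>UNIV. \<Sum>q\<in>UNIV. skew_unit p q (A $ p $ q)) $ i $ j = 2 * A $ i $ j" for i j
  proof -
    have "(\<Sum>p\<in>UNIV. \<Sum>q\<in>UNIV. skew_unit p q (A $ p $ q)) $ i $ j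
      = (\<Sum>p\<in>UNIV. \<Sum>q\<in>UNIV. if q = j then if p = i then A $ p $ q else 0 else 0)
        + (\<Sum>p\<in>UNIV. \<Sum>q\<in>UNIV. if q = i then if p = j then A $ q $ p else 0 else 0)"
      \<comment> \<open>The conditions are nested one index at a time so that
        \<open>sum.delta\<close> can evaluate the double sums.\<close>
      unfolding sum_component sum.distrib[symmetric]
    proof (intro sum.cong refl)
      fix p q
      have "- (if i = q \<and> j = p then cnj (A $ p $ q) else 0)
          = (if q = i then if p = j then A $ q $ p else 0 else 0)"
        by (simp add: A)
      moreover have "(if i = p \<and> j = q then A $ p $ q else 0)
          = (if q = j then if p = i then A $ p $ q else 0 else 0)"
        by simp
      ultimately show "skew_unit p q (A $ p $ q) $ i $ j
          = (if q = j then if p = i then A $ p $ q else 0 else 0)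
            + (if q = i then if p = j then A $ q $ p else 0 else 0)"
        unfolding skew_unit_nth diff_conv_add_uminus by (simp only:)
    qed
    then show ?thesis by (simp add: sum.delta)
  qed
  then show ?thesis
    by (simp add: vec_eq_iff scaleR_complex del: sum_component)
qed

text \<open>The matrices whose commutator with \<open>A\<close> stays in \<open>S\<close> form a
  real subspace that contains i times every orthogonal projection. Projections of rank one already
  yield every \<open>skew_unit\<close>, and these span the skew-Hermitian matrices.\<close>

lemma conj_invariant_ideal:
  fixes S :: "'n::finite cmat set"
  assumes S: "conj_invariant S" and A: "A \<in> S" and N: "N \<in> \<uu>"
  shows "comm N A \<in> S"
proof -
  have sub: "subspace S"
    using S by (simp add: conj_invariant_def)
  define T where "T = {N. comm N A \<in> S}"
  have T: "subspace T"
    using sub by (auto simp: T_def subspace_def comm_linear)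
  have proj: "\<i> \<cdot>\<^sub>m P \<in> T" if "hermitian P" "P ** P = P" for P
    using conj_invariant_comm_projection[OF S that A] by (simp add: T_def)
  have diag: "\<i> \<cdot>\<^sub>m unit_mat p p \<in> T" for p
    by (intro proj) (simp_all add: hermitian_def unit_mat_mult_unit_mat)
  have "skew_unit p q w \<in> T" for p q w
  proof (cases "p = q")
    case True
    then show ?thesis
      using T diag by (simp add: skew_unit_diag subspace_mul)
  next
    case False
    have unimodular: "skew_unit p q (\<i> * u) \<in> T" if u: "u * cnj u = 1" for u
    proof -
      \<comment> \<open>For unimodular \<open>u\<close> this is the orthogonal projection onto the
        line through u e_p + e_q. Subtracting its diagonal part leaves the off-diagonal
        generator.\<close>
      define P where "P = (1/2) *\<^sub>R (unit_mat p p + unit_mat q q + u \<cdot>\<^sub>m unit_mat p q + cnj u \<cdot>\<^sub>m unit_mat q p)"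
      have u': "u * (cnj u * x) = x" "cnj u * (u * x) = x" for x
        using u by (simp_all flip: mult.assoc add: mult.commute[of "cnj u"])
      have "hermitian P"
        by (simp add: hermitian_def P_def algebra_simps)
      moreover have "P ** P = P"
        unfolding P_def
        using False u by (simp add: matrix_add_distrib matrix_scaleR_mult matrix_smult_mult
          unit_mat_mult_unit_mat mult.commute[of "cnj u"])
          (simp add: vec_eq_iff scaleR_complex field_simps u')
      ultimately have "\<i> \<cdot>\<^sub>m P \<in> T"
        by (rule proj)
      then have "2 *\<^sub>R (\<i> \<cdot>\<^sub>m P) - \<i> \<cdot>\<^sub>m unit_mat p p - \<i> \<cdot>\<^sub>m unit_mat q q \<in> T"
        using T diag by (intro subspace_diff subspace_mul)
      also have "2 *\<^sub>R (\<i> \<cdot>\<^sub>m P) - \<i> \<cdot>\<^sub>m unit_mat p p - \<i> \<cdot>\<^sub>m unit_mat q q = skew_unit p q (\<i> * u)"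
        by (simp add: P_def vec_eq_iff skew_unit_def algebra_simps scaleR_complex)
      finally show ?thesis .
    qed
    \<comment> \<open>The choices \<open>u = 1\<close> and \<open>u = - \<i>\<close> give the
      parameters i and 1, a real basis of the complex numbers.\<close>
    have "skew_unit p q w = Im w *\<^sub>R skew_unit p q (\<i> * 1) + Re w *\<^sub>R skew_unit p q (\<i> * (- \<i>))"
      unfolding skew_unit_scaleR[symmetric] skew_unit_add[symmetric]
      by (rule arg_cong[of _ _ "skew_unit p q"]) (simp add: complex_eq_iff)
    then show ?thesis
      using T unimodular[of 1] unimodular[of "- \<i>"] by (simp add: subspace_add subspace_mul)
  qed
  then have "N \<in> T"
    using T by (subst skew_hermitian_eq_sum[OF N]) (intro subspace_mul subspace_sum)
  then show ?thesis
    by (simp add: T_def)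
qed

text \<open>Commutators with diagonal units isolate the entries at (p, q) and (q, p). One further
  commutator multiplies the parameter by i, and \<open>a\<close>, \<open>\<i> * a\<close> form a
  real basis of the complex numbers as \<open>a\<close> is nonzero.\<close>

lemma conj_invariant_contains_skew_units:
  fixes S :: "'n::finite cmat set"
  assumes S: "conj_invariant S" and A: "A \<in> S" "A \<in> \<uu>" and pq: "p \<noteq> q" "A $ p $ q \<noteq> 0"
  shows "skew_unit p q w \<in> S"
proof -
  have sub: "subspace S"
    using S by (simp add: conj_invariant_def)
  have herm: "cnj (A $ i $ j) = - A $ j $ i" for i j
    using A by (simp add: skew_hermitian_mats_def vec_eq_iff)
  define D where "D r = (\<i> \<cdot>\<^sub>m unit_mat r r :: 'n cmat)" for r
  have D: "D r \<in> \<uu>" for r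
    by (simp add: D_def skew_hermitian_mats_def) (simp add: vec_eq_iff)
  have D_nth: "comm (D r) M $ i $ j
      = (if i = r then \<i> * M $ i $ j else 0) - (if j = r then \<i> * M $ i $ j else 0)" for r M i j
    by (auto simp: D_def comm_def matrix_smult_mult unit_mat_mult)
  define a where "a = A $ p $ q"
  note ideal = conj_invariant_ideal[OF S _ D]
  have "comm (D p) (comm (D q) A) \<in> S"
    by (intro ideal A)
  \<comment> \<open>At (p, q) the inner commutator contributes the factor -i and the outer one i, so
    the entry itself reappears; outside (p, q) and (q, p) everything vanishes.\<close>
  also have "comm (D p) (comm (D q) A) = skew_unit p q a"
    using pq herm[of p q] by (auto simp: vec_eq_iff D_nth skew_unit_nth a_def)
  finally have 1: "skew_unit p q a \<in> S" .
  have "comm (D p) (skew_unit p q a) \<in> S"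
    by (intro ideal 1)
  also have "comm (D p) (skew_unit p q a) = skew_unit p q (\<i> * a)"
    using pq by (auto simp: vec_eq_iff D_nth skew_unit_nth)
  finally have 2: "skew_unit p q (\<i> * a) \<in> S" .
  have "w = Re (w / a) *\<^sub>R a + Im (w / a) *\<^sub>R (\<i> * a)"
  proof -
    have "Re (w / a) *\<^sub>R a + Im (w / a) *\<^sub>R (\<i> * a) = (Re (w / a) + \<i> * Im (w / a)) * a"
      by (simp add: scaleR_complex algebra_simps)
    also have "\<dots> = w"
      using pq by (subst complex_eq[symmetric]) (simp add: a_def)
    finally show ?thesis ..
  qed
  then have "skew_unit p q w = Re (w / a) *\<^sub>R skew_unit p q a + Im (w / a) *\<^sub>R skew_unit p q (\<i> * a)"
    by (metis skew_unit_add skew_unit_scaleR)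
  then show ?thesis
    using sub 1 2 by (simp add: subspace_add subspace_mul)
qed

section \<open>Generating the whole unitary Lie algebra from one nonscalar element of nonzero
  trace\<close>

lemma skew_unit_skew_hermitian: "skew_unit p q w \<in> \<uu>"
  by (simp add: skew_hermitian_mats_def skew_unit_def)

lemma comm_skew_unit_nth:
  "comm (skew_unit p q w) A $ i $ j
    = (if i = p then w * A $ q $ j else 0) - (if i = q then cnj w * A $ p $ j else 0)
      - (if j = q then w * A $ i $ p else 0) + (if j = p then cnj w * A $ i $ q else 0)"
  by (simp add: comm_def skew_unit_def matrix_diff_distrib matrix_smult_mult unit_mat_mult)

text \<open>Being nonscalar supplies one off-diagonal generator; commutators carry it to all pairs
  of indices and then to all traceless diagonal matrices. The nonzero trace supplies the remaining
  diagonal direction.\<close>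

lemma conj_invariant_eq_skew_hermitian:
  fixes S :: "'n::finite cmat set"
  assumes S: "conj_invariant S" and A: "A \<in> S" "A \<in> \<uu>"
    and nonscalar: "\<And>z. A \<noteq> z \<cdot>\<^sub>m mat 1" and tr: "trace A \<noteq> 0"
  shows "\<uu> \<subseteq> S"
proof -
  have sub: "subspace S"
    using S by (simp add: conj_invariant_def)
  note ideal = conj_invariant_ideal[OF S _ skew_unit_skew_hermitian]
  have "\<exists>p q. p \<noteq> q \<and> (\<forall>w. skew_unit p q w \<in> S)"
  proof (cases "\<exists>p q. p \<noteq> q \<and> A $ p $ q \<noteq> 0")
    case True
    then show ?thesis
      using conj_invariant_contains_skew_units[OF S A] by blast
  next
    case False
    have "\<exists>p q. A $ p $ p \<noteq> A $ q $ q"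
    proof (rule ccontr)
      assume "\<not> ?thesis"
      \<comment> \<open>All diagonal entries agree here, so an arbitrary index,
        \<open>undefined\<close>, names their common value.\<close>
      then have "A = (A $ undefined $ undefined) \<cdot>\<^sub>m mat 1"
        using False by (auto simp: vec_eq_iff mat_def)
      then show False
        using nonscalar by blast
    qed
    then obtain p q where pq: "A $ p $ p \<noteq> A $ q $ q"
      by blast
    \<comment> \<open>For diagonal \<open>A\<close> this commutator has the entry
      \<open>A $ q $ q - A $ p $ p\<close> at (p, q), which reduces to the case of a nonzero
      off-diagonal entry.\<close>
    then have "p \<noteq> q" "comm (skew_unit p q 1) A $ p $ q \<noteq> 0"
      by (auto simp: comm_skew_unit_nth)
    moreover have "comm (skew_unit p q 1) A \<in> S" "comm (skew_unit p q 1) A \<in> \<uu>"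
      using ideal A comm_skew_hermitian skew_unit_skew_hermitian by blast+
    ultimately show ?thesis
      using conj_invariant_contains_skew_units[OF S] by blast
  qed
  then obtain p q where pq: "p \<noteq> q" "\<And>w. skew_unit p q w \<in> S"
    by blast
  \<comment> \<open>Replaces the second index \<open>k\<close> by \<open>l\<close>. Together with
    the swap of indices, this leads from the single pair (p, q) to every pair by way of
    \<open>p\<close>.\<close>
  have move: "skew_unit j l w \<in> S" if "j \<noteq> k" "k \<noteq> l" "j \<noteq> l" "\<And>w. skew_unit j k w \<in> S" for j k l w
  proof -
    have "comm (skew_unit l k 1) (skew_unit j k w) = skew_unit j l w"
      using that
      by (simp add: comm_def skew_unit_def matrix_diff_distrib matrix_smult_mult unit_mat_mult_unit_mat)
    then show ?thesis
      using ideal that by metis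
  qed
  have from_p: "skew_unit p l w \<in> S" if "l \<noteq> p" for l w
    using move[OF pq(1) _ _ pq(2)] pq that by (cases "l = q") auto
  have offdiag: "skew_unit k l w \<in> S" if "k \<noteq> l" for k l w
  proof (cases "k = p")
    case True
    then show ?thesis using from_p[of l w] that by simp
  next
    case False
    have "skew_unit k p w \<in> S" for w
      unfolding skew_unit_swap[of k] using False by (rule from_p)
    then show ?thesis
      using move[of k p l] False that by (cases "l = p") auto
  qed
  have diag_diff: "\<i> \<cdot>\<^sub>m (unit_mat k k - unit_mat l l) \<in> S" for k l
  proof (cases "k = l")
    case True
    then show ?thesis
      using subspace_0[OF sub] by simp
  next
    case False
    have "comm (skew_unit k l \<i>) (skew_unit k l 1) = - 2 *\<^sub>R (\<i> \<cdot>\<^sub>m (unit_mat k k - unit_mat l l))"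
      using False
      by (simp add: comm_def skew_unit_def matrix_diff_distrib matrix_smult_mult unit_mat_mult_unit_mat)
        (simp add: vec_eq_iff scaleR_complex algebra_simps)
    then have "\<i> \<cdot>\<^sub>m (unit_mat k k - unit_mat l l)
        = (- 1 / 2) *\<^sub>R comm (skew_unit k l \<i>) (skew_unit k l 1)"
      by simp
    also have "\<dots> \<in> S"
      by (intro subspace_mul sub ideal offdiag[OF False])
    finally show ?thesis .
  qed
  have herm: "Re (A $ k $ k) = 0" for k
  proof -
    have "dagger A $ k $ k = (- A) $ k $ k"
      using A(2) by (simp only: skew_hermitian_mats_def mem_Collect_eq)
    then show ?thesis
      by (simp add: complex_eq_iff)
  qed
  define t where "t = (\<Sum>k\<in>UNIV. Im (A $ k $ k))"
  have "trace A = \<i> * t"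
    by (simp add: trace_def t_def complex_eq_iff herm)
  then have "t \<noteq> 0"
    using tr by auto
  have diag: "\<i> \<cdot>\<^sub>m unit_mat l l \<in> S" for l
  proof -
    \<comment> \<open>The off-diagonal part of \<open>A\<close>, which lies in \<open>S\<close> by
      \<open>offdiag\<close>.\<close>
    define R where "R = (1/2) *\<^sub>R (\<Sum>k\<in>UNIV. \<Sum>m\<in>UNIV - {k}. skew_unit k m (A $ k $ m))"
    have "A = R + (\<Sum>k\<in>UNIV. Im (A $ k $ k) *\<^sub>R (\<i> \<cdot>\<^sub>m unit_mat k k))"
    proof -
      have "(\<Sum>m\<in>UNIV. skew_unit k m (A $ k $ m))
          = (\<Sum>m\<in>UNIV - {k}. skew_unit k m (A $ k $ m)) + skew_unit k k (A $ k $ k)" for k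
        by (simp add: sum.remove[of UNIV k])
      then have "(1/2) *\<^sub>R (\<Sum>k\<in>UNIV. \<Sum>m\<in>UNIV. skew_unit k m (A $ k $ m))
          = R + (\<Sum>k\<in>UNIV. (1/2) *\<^sub>R skew_unit k k (A $ k $ k))"
        by (simp add: R_def sum.distrib scaleR_add_right scaleR_sum_right)
      then show ?thesis
        using skew_hermitian_eq_sum[OF A(2)] by (simp add: skew_unit_diag)
    qed
    \<comment> \<open>Subtracting the unit at \<open>l\<close> from every diagonal unit leaves a
      traceless sum that lies in \<open>S\<close>; the surplus is \<open>t\<close> copies of the
      unit at \<open>l\<close>, and \<open>t\<close> is nonzero.\<close>
    moreover have "(\<Sum>k\<in>UNIV. Im (A $ k $ k) *\<^sub>R (\<i> \<cdot>\<^sub>m unit_mat k k))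
        = (\<Sum>k\<in>UNIV. Im (A $ k $ k) *\<^sub>R (\<i> \<cdot>\<^sub>m (unit_mat k k - unit_mat l l))) + t *\<^sub>R (\<i> \<cdot>\<^sub>m unit_mat l l)"
      by (simp add: t_def scaleR_sum_left sum.distrib[symmetric])
        (intro sum.cong refl, simp add: vec_eq_iff algebra_simps)
    ultimately have "t *\<^sub>R (\<i> \<cdot>\<^sub>m unit_mat l l)
        = A - R - (\<Sum>k\<in>UNIV. Im (A $ k $ k) *\<^sub>R (\<i> \<cdot>\<^sub>m (unit_mat k k - unit_mat l l)))"
      by (simp add: algebra_simps)
    also have "\<dots> \<in> S"
      unfolding R_def
      by (intro subspace_diff sub A subspace_sum subspace_mul diag_diff offdiag) auto
    finally have "(1 / t) *\<^sub>R (t *\<^sub>R (\<i> \<cdot>\<^sub>m unit_mat l l)) \<in> S"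
      using sub subspace_mul by blast
    then show ?thesis
      using \<open>t \<noteq> 0\<close> by simp
  qed
  have "skew_unit k l w \<in> S" for k l w
  proof (cases "k = l")
    case True
    then show ?thesis
      using sub diag by (simp add: skew_unit_diag subspace_mul)
  qed (rule offdiag)
  then show ?thesis
    using skew_hermitian_eq_sum sub by (metis (no_types, lifting) subsetI subspace_mul subspace_sum)
qed

section \<open>The orbit of a product state under the dynamical Lie algebra\<close>

lemma subspace_ad_sum: "subspace (ad_sum L P)"
  by (simp add: ad_sum_def)

lemma ad_iter_subset_ad_sum: "ad_iter k L P \<subseteq> ad_sum L P"
  unfolding ad_sum_def by (intro subset_trans[OF _ span_superset] UN_upper UNIV_I)

text \<open>Commutation with \<open>M\<close> sends level \<open>k\<close> of the iteration into
  level \<open>Suc k\<close>; linearity extends this from the union to its span.\<close>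

lemma comm_mem_ad_sum:
  assumes M: "M \<in> L" and Q: "Q \<in> ad_sum L P"
  shows "comm M Q \<in> ad_sum L P"
proof -
  have "subspace {Q. comm M Q \<in> ad_sum L P}"
    using subspace_ad_sum[of L P] by (auto simp: subspace_def comm_linear)
  moreover have "(\<Union>k. ad_iter k L P) \<subseteq> {Q. comm M Q \<in> ad_sum L P}"
  proof clarify
    fix k Q
    assume "Q \<in> ad_iter k L P"
    then have "comm M Q \<in> ad_iter (Suc k) L P"
      using M by (auto intro!: span_base)
    then show "comm M Q \<in> ad_sum L P"
      using ad_iter_subset_ad_sum by blast
  qed
  ultimately show ?thesis
    using Q span_minimal unfolding ad_sum_def by blast
qed

lemma ad_sum_skew_hermitian:
  assumes "L \<subseteq> \<uu>" "P \<subseteq> \<uu>"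
  shows "ad_sum L P \<subseteq> \<uu>"
proof -
  have "ad_iter k L P \<subseteq> \<uu>" for k
  proof (induction k)
    case (Suc k)
    then have "{comm X Q | X Q. X \<in> L \<and> Q \<in> ad_iter k L P} \<subseteq> \<uu>"
      using assms comm_skew_hermitian by blast
    then show ?case
      by (simp add: span_minimal subspace_skew_hermitian)
  qed (use assms in simp)
  then show ?thesis
    unfolding ad_sum_def by (intro span_minimal subspace_skew_hermitian) auto
qed

section \<open>Generated Lie algebras and the partial trace on skew-Hermitian matrices\<close>

lemma lie_subalgebra_lie_generated: "lie_subalgebra (lie_generated G)"
  unfolding lie_generated_def
  by (rule hull_in) (auto simp: lie_subalgebra_def intro: subspace_Inter)

lemma lie_generated_skew_hermitian: "G \<subseteq> \<uu> \<Longrightarrow> lie_generated G \<subseteq> \<uu>"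
  unfolding lie_generated_def
  by (rule hull_minimal) (auto simp: lie_subalgebra_def subspace_skew_hermitian comm_skew_hermitian)

lemma linear_partial_trace: "linear Tr\<^sub>A"
  by (simp add: linear_iff partial_trace_def vec_eq_iff sum.distrib scaleR_sum_right)

lemma partial_trace_skew_hermitian: "M \<in> \<uu> \<Longrightarrow> Tr\<^sub>A M \<in> \<uu>"
  by (simp add: skew_hermitian_mats_def vec_eq_iff partial_trace_def sum_negf)

theorem theorem1:
  fixes B :: "'s::finite cmat" and C :: "'a::finite cmat"
    and J :: "'j set" and Bs :: "'j \<Rightarrow> 's cmat" and Cs :: "'j \<Rightarrow> 'a cmat"
    and K :: "'k set" and Ls :: "'k \<Rightarrow> 'a cmat"
    and H_S H_A H_I :: "('s \<times> 'a) cmat"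
    and \<L> \<V> :: "('s \<times> 'a) cmat set"
    and \<rho>\<^sub>S :: "'s cmat" and \<rho>\<^sub>A :: "'a cmat"
  assumes finJ: "finite J" and finK: "finite K"
    and herm_S: "hermitian B" and herm_A: "hermitian C"
    and herm_I: "\<And>j. j \<in> J \<Longrightarrow> hermitian (Bs j) \<and> hermitian (Cs j)"
    and herm_L: "\<And>k. k \<in> K \<Longrightarrow> hermitian (Ls k)"
    and H_S: "H_S = B \<otimes>\<^sub>K mat 1"
    and H_A: "H_A = mat 1 \<otimes>\<^sub>K C"
    and H_I: "H_I = (\<Sum>j\<in>J. Bs j \<otimes>\<^sub>K Cs j)"
    and traceless: "trace H_S = 0" "trace H_A = 0" "trace H_I = 0"
      "\<And>k. k \<in> K \<Longrightarrow> trace (Ls k) = 0"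
    and \<L>: "\<L> = dynamical_lie_algebra (H_S + H_I + H_A) (Ls ` K)"
    and dens_S: "density_matrix \<rho>\<^sub>S" and dens_A: "density_matrix \<rho>\<^sub>A"
    and not_mixed: "\<rho>\<^sub>S \<noteq> (1 / of_nat CARD('s)) \<cdot>\<^sub>m mat 1"
    and \<V>: "\<V> = ad_sum \<L> (span {\<i> \<cdot>\<^sub>m (\<rho>\<^sub>S \<otimes>\<^sub>K \<rho>\<^sub>A)})"
    and controllable: "\<And>X. X \<in> SU \<Longrightarrow>
      \<exists>U\<in>exp_group \<L>. Tr\<^sub>A (U ** (\<rho>\<^sub>S \<otimes>\<^sub>K \<rho>\<^sub>A) ** dagger U) = X ** \<rho>\<^sub>S ** dagger X"
  shows "Tr\<^sub>A ` \<V> = \<uu>"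
proof
  define \<rho> where "\<rho> = \<i> \<cdot>\<^sub>m (\<rho>\<^sub>S \<otimes>\<^sub>K \<rho>\<^sub>A)"
  have herm: "hermitian \<rho>\<^sub>S" "hermitian \<rho>\<^sub>A" and tr: "trace \<rho>\<^sub>S = 1"
    using dens_S dens_A by (auto simp: density_matrix_def pos_semidef_def)
  have "hermitian (H_S + H_I + H_A)"
    unfolding H_S H_A H_I using herm_S herm_A herm_I
    by (intro hermitian_add hermitian_sum hermitian_kron hermitian_one) auto
  then have L_skew: "\<L> \<subseteq> \<uu>"
    unfolding \<L> dynamical_lie_algebra_def
    by (intro lie_generated_skew_hermitian)
      (auto intro!: smult_hermitian_skew hermitian_kron hermitian_one herm_L)
  have L_sub: "subspace \<L>"
    using lie_subalgebra_lie_generated by (auto simp: \<L> dynamical_lie_algebra_def lie_subalgebra_def)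
  have "\<rho> \<in> \<uu>"
    unfolding \<rho>_def by (intro smult_hermitian_skew hermitian_kron herm)
  then have V_skew: "\<V> \<subseteq> \<uu>"
    unfolding \<V> \<rho>_def[symmetric]
    by (intro ad_sum_skew_hermitian L_skew span_minimal subspace_skew_hermitian) auto
  then show "Tr\<^sub>A ` \<V> \<subseteq> \<uu>"
    using partial_trace_skew_hermitian by blast
  have V_sub: "subspace \<V>"
    by (simp add: \<V> subspace_ad_sum)
  have "\<rho> \<in> \<V>"
    using ad_iter_subset_ad_sum[of 0 \<L> "span {\<rho>}"] span_base[of \<rho> "{\<rho>}"]
    by (auto simp: \<V> \<rho>_def)
  define W where "W = Tr\<^sub>A ` \<V>"
  have W_sub: "subspace W"
    unfolding W_def by (intro linear_subspace_image linear_partial_trace V_sub)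
  define A where "A = \<i> \<cdot>\<^sub>m \<rho>\<^sub>S"
  have orbit_SU: "X ** A ** dagger X \<in> W" if "X \<in> SU" for X
  proof -
    obtain U where U: "U \<in> exp_group \<L>"
      "Tr\<^sub>A (U ** (\<rho>\<^sub>S \<otimes>\<^sub>K \<rho>\<^sub>A) ** dagger U) = X ** \<rho>\<^sub>S ** dagger X"
      using controllable \<open>X \<in> SU\<close> by blast
    have "U ** \<rho> ** dagger U \<in> \<V>"
      using exp_group_conj[OF V_sub _ L_sub L_skew U(1)] comm_mem_ad_sum \<open>\<rho> \<in> \<V>\<close> unfolding \<V> by blast
    \<comment> \<open>The partial trace is complex linear, so the factor i passes through it and the
      controllability hypothesis applies.\<close>
    moreover have "Tr\<^sub>A (U ** \<rho> ** dagger U) = X ** A ** dagger X"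
      by (simp add: \<rho>_def A_def matrix_smult_mult partial_trace_smult U)
    ultimately show ?thesis
      unfolding W_def by (metis imageI)
  qed
  \<comment> \<open>The orbit under all unitaries makes its span \<open>conj_invariant\<close>; by
    \<open>unitary_rescale_SU\<close> each of its points is also reached from
    \<open>SU\<close>.\<close>
  define orbit where "orbit = {U ** A ** dagger U | U. U \<in> unitary_mats}"
  have "orbit \<subseteq> W"
    unfolding orbit_def using orbit_SU unitary_rescale_SU by (smt (verit) mem_Collect_eq subsetI)
  then have "span orbit \<subseteq> W"
    using W_sub by (rule span_minimal)
  moreover have "\<uu> \<subseteq> span orbit"
  proof (rule conj_invariant_eq_skew_hermitian)
    show "conj_invariant (span orbit)"
      unfolding conj_invariant_def
    proof (intro conjI ballI subspace_span)
      fix U :: "'s cmat" and Y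
      assume U: "U \<in> unitary_mats" and Y: "Y \<in> span orbit"
      have "linear (\<lambda>Y. U ** Y ** dagger U)"
        by (simp add: linear_iff matrix_add_distrib matrix_scaleR_mult)
      then have "U ** Y ** dagger U \<in> span ((\<lambda>Y. U ** Y ** dagger U) ` orbit)"
        using Y linear_span_image by blast
      moreover have "(\<lambda>Y. U ** Y ** dagger U) ` orbit \<subseteq> orbit"
      proof clarify
        fix Y assume "Y \<in> orbit"
        then obtain W where W: "W \<in> unitary_mats" "Y = W ** A ** dagger W"
          by (auto simp: orbit_def)
        have "U ** W ** dagger (U ** W) = U ** (W ** dagger W) ** dagger U"
          by (simp add: matrix_mul_assoc)
        then have "U ** W \<in> unitary_mats"
          using U W(1) by (simp add: unitary_mats_def)
        moreover have "U ** Y ** dagger U = (U ** W) ** A ** dagger (U ** W)"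
          by (simp add: W matrix_mul_assoc)
        ultimately show "U ** Y ** dagger U \<in> orbit"
          unfolding orbit_def by blast
      qed
      ultimately show "U ** Y ** dagger U \<in> span orbit"
        using span_mono by blast
    qed
    have "A = mat 1 ** A ** dagger (mat 1)"
      by simp
    moreover have "mat 1 \<in> (unitary_mats :: 's cmat set)"
      by (simp add: unitary_mats_def)
    ultimately show "A \<in> span orbit"
      unfolding orbit_def by (intro span_base) blast
    show "A \<in> \<uu>"
      unfolding A_def by (intro smult_hermitian_skew herm)
    show "trace A \<noteq> 0"
      by (simp add: A_def trace_smult tr)
    show "A \<noteq> z \<cdot>\<^sub>m mat 1" for z
    proof
      assume "A = z \<cdot>\<^sub>m mat 1"
      then have \<rho>\<^sub>S: "\<rho>\<^sub>S = (- \<i> * z) \<cdot>\<^sub>m mat 1"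
        using smult_mat_simps(1)[of "- \<i>" "\<i>" "\<rho>\<^sub>S"] by (simp add: A_def)
      \<comment> \<open>A scalar density matrix is fixed by its trace: comparing traces forces the
        maximally mixed state, which \<open>not_mixed\<close> excludes.\<close>
      then have "- \<i> * z * of_nat CARD('s) = 1"
        using tr by (simp add: trace_smult) (simp add: trace_def mat_def)
      then have "- \<i> * z = 1 / of_nat CARD('s)"
        by (simp add: field_simps)
      then show False
        using \<rho>\<^sub>S not_mixed by simp
    qed
  qed
  ultimately show "\<uu> \<subseteq> Tr\<^sub>A ` \<V>"
    unfolding W_def by blast
qed

end
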